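(* Let $d\ge 1$, $\sigma>0$ and $s\geq 0$. (1) Let $U$ be holomorphic in $S_\sigma$ and such that $M_0:= \sup_{|y|<\sigma} \Vert U_y\Vert_{H^s(\mathbf{T}^d)}<+ \infty$, and set $u = U_0$. Then: (i) If $d=1$, then $u\in\mathcal{H}^{\sigma,s}(\mathbf{T}^d)$ and $\Vert u \Vert_{\mathcal{H}^{\sigma,s}} \leq 2M_0$. (ii) If $d\geq 2$, then $u\in\mathcal{H}^{\delta,s}(\mathbf{T}^d)$ for any $\delta<\sigma$, and there exists a constant $C_\delta>0$ such that $\Vert u \Vert_{\mathcal{H}^{\delta,s}} \leq C_\delta M_0$. (2) Let $U$ be holomorphic in $S_\sigma$ and such that $$M_1:= \sup_{|y|<\sigma} \Vert U_y\Vert_{H^{s'}(\mathbf{T}^d)}<+ \infty \quad\text{with}\quad s'>s + \frac{d-1}{4}.$$ Then the function $u = U_0$ belongs to $\mathcal{H}^{\sigma,s}(\mathbf{T}^d)$ and there exists a constant $C>0$ such that $\Vert u \Vert_{\mathcal{H}^{\sigma,s}} \leq C M_1$.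
   Context: $\mathbf{T}^d=(\mathbf{R}/2\pi\mathbf{Z})^d$, $\widehat u(\xi)=\int_{\mathbf{T}^d}e^{-ix\cdot\xi}u(x)\,dx$ for $\xi\in\mathbf{Z}^d$, $\langle\xi\rangle=(1+|\xi|^2)^{1/2}$. For $\sigma\ge 0$, $s\ge0$, $$\mathcal{H}^{\sigma,s}(\mathbf{T}^d)=\Big\{u\in L^2(\mathbf{T}^d):\ \Vert u\Vert_{\mathcal{H}^{\sigma,s}}^2:=\sum_{\xi\in\mathbf{Z}^d}e^{2\sigma|\xi|}\langle\xi\rangle^{2s}|\widehat u(\xi)|^2<+\infty\Big\},$$ and $H^s(\mathbf{T}^d)=\mathcal{H}^{0,s}(\mathbf{T}^d)$ with the same norm ($\sigma=0$). Here $S_\sigma=\{z\in\mathbf{C}^d:\ \operatorname{Re} z\in\mathbf{T}^d,\ |\operatorname{Im} z|<\sigma\}$ (i.e. functions on $S_\sigma$ are $2\pi$-periodic in each $\operatorname{Re}z_j$), $|\cdot|$ is the Euclidean norm, and for $y\in\mathbf{R}^d$ with $|y|<\sigma$, $U_y:\mathbf{T}^d\to\mathbf{C}$ denotes the function $x\mapsto U(x+iy)$. *)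

theory Defs
  imports "HOL-Analysis.Analysis"
begin

text \<open>
  The dimension is \<open>d = CARD('n)\<close>. A function on the torus \<open>T^d = (R/2\<pi>Z)^d\<close> is a function on
  \<open>R^d\<close> that is \<open>2\<pi>\<close>-periodic in each coordinate; integrals over the torus are Lebesgue integrals
  over the cell \<open>[0,2\<pi>]^d\<close>.
\<close>

definition torus_cell :: "(real ^ 'n) set" where
  "torus_cell = cbox 0 (\<chi> i. 2 * pi)"

definition torus_periodic :: "(real ^ 'n \<Rightarrow> complex) \<Rightarrow> bool" where
  "torus_periodic u \<longleftrightarrow> (\<forall>x j. u (x + axis j (2 * pi)) = u x)"

text \<open>
  \<open>L\<^sup>2\<close> consists of functions here, not of classes modulo null sets; the Fourier coefficients, and
  hence the Sobolev-type conditions and norms below, depend only on the class.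
\<close>

definition L2_torus :: "(real ^ 'n \<Rightarrow> complex) set" where
  "L2_torus = {u. torus_periodic u
     \<and> u \<in> borel_measurable (lebesgue_on torus_cell)
     \<and> integrable (lebesgue_on torus_cell) (\<lambda>x. (norm (u x))\<^sup>2)}"

definition freq :: "int ^ 'n \<Rightarrow> real ^ 'n" where
  "freq \<xi> = (\<chi> i. real_of_int (\<xi> $ i))"

definition fourier_coeff :: "(real ^ 'n \<Rightarrow> complex) \<Rightarrow> int ^ 'n \<Rightarrow> complex" where
  "fourier_coeff u \<xi> =
     (LINT x|lebesgue_on torus_cell. exp (- \<i> * complex_of_real (x \<bullet> freq \<xi>)) * u x)"

definition japanese_bracket :: "int ^ 'n \<Rightarrow> real" where
  "japanese_bracket \<xi> = sqrt (1 + (norm (freq \<xi>))\<^sup>2)"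

definition H_term :: "real \<Rightarrow> real \<Rightarrow> (real ^ 'n \<Rightarrow> complex) \<Rightarrow> int ^ 'n \<Rightarrow> real" where
  "H_term \<sigma> s u \<xi> =
     exp (2 * \<sigma> * norm (freq \<xi>)) * japanese_bracket \<xi> powr (2 * s) * (norm (fourier_coeff u \<xi>))\<^sup>2"

definition H_space :: "real \<Rightarrow> real \<Rightarrow> (real ^ 'n \<Rightarrow> complex) set" where
  "H_space \<sigma> s = {u \<in> L2_torus. H_term \<sigma> s u summable_on UNIV}"

text \<open>Meaningful only on \<^term>\<open>H_space \<sigma> s\<close>: a divergent sum has \<^const>\<open>infsum\<close> equal to \<open>0\<close>.\<close>

definition H_norm :: "real \<Rightarrow> real \<Rightarrow> (real ^ 'n \<Rightarrow> complex) \<Rightarrow> real" where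
  "H_norm \<sigma> s u = sqrt (\<Sum>\<^sub>\<infinity>\<xi>. H_term \<sigma> s u \<xi>)"

abbreviation Sobolev_space :: "real \<Rightarrow> (real ^ 'n \<Rightarrow> complex) set" where
  "Sobolev_space s \<equiv> H_space 0 s"

abbreviation Sobolev_norm :: "real \<Rightarrow> (real ^ 'n \<Rightarrow> complex) \<Rightarrow> real" where
  "Sobolev_norm s \<equiv> H_norm 0 s"

text \<open>The preimage in \<open>C^d\<close> of the strip \<open>S\<^sub>\<sigma>\<close>, whose points have real part in the torus.\<close>

definition strip :: "real \<Rightarrow> (complex ^ 'n) set" where
  "strip \<sigma> = {z. norm (\<chi> i. Im (z $ i)) < \<sigma>}"

text \<open>
  Holomorphy in several variables: existence of a complex-linear total derivative at every point
  (intended for open \<open>S\<close>).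
\<close>

definition holomorphic_several_on :: "(complex ^ 'n \<Rightarrow> complex) \<Rightarrow> (complex ^ 'n) set \<Rightarrow> bool" where
  "holomorphic_several_on f S \<longleftrightarrow>
     (\<forall>z\<in>S. \<exists>D. (f has_derivative D) (at z) \<and> (\<forall>c v. D (c *s v) = c * D v))"

definition holomorphic_in_strip :: "real \<Rightarrow> (complex ^ 'n \<Rightarrow> complex) \<Rightarrow> bool" where
  "holomorphic_in_strip \<sigma> U \<longleftrightarrow>
     holomorphic_several_on U (strip \<sigma>) \<and>
     (\<forall>z\<in>strip \<sigma>. \<forall>j. U (z + axis j (complex_of_real (2 * pi))) = U z)"

text \<open>\<open>U\<^sub>y(x) = U(x + iy)\<close>\<close>

definition slice :: "(complex ^ 'n \<Rightarrow> complex) \<Rightarrow> real ^ 'n \<Rightarrow> real ^ 'n \<Rightarrow> complex" where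
  "slice U y = (\<lambda>x. U (\<chi> i. Complex (x $ i) (y $ i)))"

text \<open>
  Finiteness of the supremum of the \<open>H^s\<close> norms of \<open>U\<^sub>y\<close> over \<open>|y| < \<sigma>\<close>, where a function outside
  \<open>H^s\<close> counts as having norm \<open>+\<infinity>\<close>; \<open>slice_sup\<close> is then the supremum itself.
\<close>

definition slice_sup_finite :: "real \<Rightarrow> real \<Rightarrow> (complex ^ 'n \<Rightarrow> complex) \<Rightarrow> bool" where
  "slice_sup_finite \<sigma> s U \<longleftrightarrow>
     (\<forall>y. norm y < \<sigma> \<longrightarrow> slice U y \<in> Sobolev_space s) \<and>
     bdd_above ((\<lambda>y. Sobolev_norm s (slice U y)) ` {y. norm y < \<sigma>})"

definition slice_sup :: "real \<Rightarrow> real \<Rightarrow> (complex ^ 'n \<Rightarrow> complex) \<Rightarrow> real" where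
  "slice_sup \<sigma> s U = (SUP y\<in>{y. norm y < \<sigma>}. Sobolev_norm s (slice U y))"

end

theory Submission
  imports Defs "HOL-Complex_Analysis.Cauchy_Integral_Theorem"
begin

text \<open>
  Write \<open>c\<^sub>y(\<xi>)\<close> for the Fourier coefficients of \<open>U\<^sub>y\<close>. Translating a periodic function does not
  change its integral over the cell, so Cauchy's theorem gives \<open>c\<^sub>y(\<xi>) = exp(-y\<cdot>\<xi>) c\<^sub>0(\<xi>)\<close>. Hence the
  sums of \<open>exp(-2y\<cdot>\<xi>) \<langle>\<xi>\<rangle>^(2s) |c\<^sub>0(\<xi>)|^2\<close> are bounded uniformly in \<open>|y| < \<sigma>\<close>, and by continuity also
  for \<open>|y| = \<sigma>\<close>. It remains to dominate the radial weight by finitely many of these exponentials.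
  In dimension one \<open>y = \<plusminus>\<sigma>\<close> will do, and for a smaller width a fixed finite net of directions.
  For the full width, a net of mesh \<open>1/m\<close> costs an error of order \<open>|\<xi>|/m^2\<close> in the exponent, so the
  shell \<open>\<langle>\<xi>\<rangle> \<approx> 4^k\<close> needs \<open>m = 2^k\<close> and about \<open>2^(k(d-1))\<close> directions, while the spare derivatives
  gain a factor \<open>4^(-2k(s'-s))\<close>: the shells sum geometrically because \<open>s' - s > (d-1)/4\<close>.
\<close>

subsection \<open>Integrals of periodic functions\<close>

lemma torus_periodic_int:
  assumes "torus_periodic u"
  shows "u (x + axis j (2 * pi * real_of_int k)) = u x"
proof -
  have p: "u (x + axis j (2 * pi)) = u x" for x
    using assms by (simp add: torus_periodic_def)
  have nat: "u (x + axis j (2 * pi * real n)) = u x" for x n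
  proof (induction n)
    case 0
    have "x + axis j (2 * pi * real 0) = x" by (simp add: vec_eq_iff axis_def)
    then show ?case by metis
  next
    case (Suc n)
    have "x + axis j (2 * pi * real (Suc n)) = (x + axis j (2 * pi * real n)) + axis j (2 * pi)"
      by (simp add: vec_eq_iff axis_def algebra_simps)
    then show ?case using Suc p by metis
  qed
  show ?thesis
  proof (cases "k \<ge> 0")
    case True
    then show ?thesis using nat[of x "nat k"] by simp
  next
    case False
    have "x = (x + axis j (2 * pi * real_of_int k)) + axis j (2 * pi * real (nat (- k)))"
      using False by (simp add: vec_eq_iff axis_def algebra_simps)
    then show ?thesis using nat by metis
  qed
qed

lemma torus_periodic_shift:
  assumes "torus_periodic f"
  shows "torus_periodic (\<lambda>x. f (x + h))"
  unfolding torus_periodic_def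
proof (intro allI)
  fix x j
  have "x + axis j (2 * pi) + h = (x + h) + axis j (2 * pi)" by (simp add: algebra_simps)
  then show "f (x + axis j (2 * pi) + h) = f (x + h)"
    using assms unfolding torus_periodic_def by metis
qed

text \<open>By periodicity the shift reduces to some b in [0, 2 pi]. The hyperplane x_j = 2 pi - b
  cuts the cell into two boxes; moving the lower one by b and, again by periodicity, the upper one
  by b - 2 pi yields the two boxes into which x_j = b cuts the cell.\<close>

lemma integral_torus_cell_axis_shift:
  fixes f :: "real ^ 'n \<Rightarrow> complex"
  assumes cont: "continuous_on UNIV f" and per: "torus_periodic f"
  shows "integral torus_cell (\<lambda>x. f (x + axis j a)) = integral torus_cell f"
proof -
  define b where "b = frac (a / (2 * pi)) * (2 * pi)"
  have b: "0 \<le> b" "b \<le> 2 * pi"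
    using frac_lt_1[of "a / (2*pi)"] by (auto simp: b_def)
  have "a = b + 2 * pi * real_of_int \<lfloor>a / (2 * pi)\<rfloor>"
    by (simp add: b_def frac_def algebra_simps)
  then have "x + axis j a = (x + axis j b) + axis j (2 * pi * real_of_int \<lfloor>a / (2 * pi)\<rfloor>)" for x
    by (simp add: vec_eq_iff axis_def)
  then have fa: "f (x + axis j a) = f (x + axis j b)" for x
    using torus_periodic_int[OF per] by metis
  have fb: "f (x + axis j b) = f (x + axis j (b - 2 * pi))" for x
  proof -
    have "x + axis j b = (x + axis j (b - 2 * pi)) + axis j (2 * pi)"
      by (simp add: vec_eq_iff axis_def)
    then show ?thesis using per unfolding torus_periodic_def by metis
  qed
  \<comment> \<open>For the cut at x_j = c, \<open>q c\<close> is the upper corner of the lower box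
    and \<open>p c\<close> the lower corner of the upper box.\<close>
  define p q :: "real \<Rightarrow> real ^ 'n"
    where "p c = (\<chi> i. if i = j then c else 0)" and "q c = (\<chi> i. if i = j then c else 2 * pi)" for c
  have basis: "axis j 1 \<in> (Basis :: (real ^ 'n) set)" by (simp add: axis_in_Basis_iff)
  have low: "torus_cell \<inter> {x. x \<bullet> axis j 1 \<le> c} = cbox 0 (q c)" if "c \<le> 2 * pi" for c
    using that unfolding torus_cell_def q_def
    by (force simp: mem_box_cart inner_axis set_eq_iff)
  have high: "torus_cell \<inter> {x. x \<bullet> axis j 1 \<ge> c} = cbox (p c) (\<chi> i. 2 * pi)" if "0 \<le> c" for c
    using that unfolding torus_cell_def p_def
    by (force simp: mem_box_cart inner_axis set_eq_iff)
  have split: "integral torus_cell g = integral (cbox 0 (q c)) g + integral (cbox (p c) (\<chi> i. 2 * pi)) g"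
    if "continuous_on UNIV g" "0 \<le> c" "c \<le> 2 * pi" for g :: "real ^ 'n \<Rightarrow> complex" and c
  proof -
    have "g integrable_on cbox 0 (\<chi> i. 2 * pi)"
      using that(1) by (intro integrable_continuous) (auto intro: continuous_on_subset)
    from integral_split[OF this basis, of c] show ?thesis
      using low[OF that(3)] high[OF that(2)] by (simp add: torus_cell_def)
  qed
  have shift: "integral (cbox c d) (\<lambda>x. f (x + h)) = integral (cbox (c + h) (d + h)) f" for c d h
    using integral_shift_cbox_plus[of c d f h] by (simp add: o_def add.commute)
  have "integral torus_cell (\<lambda>x. f (x + axis j b)) =
      integral (cbox 0 (q (2*pi - b))) (\<lambda>x. f (x + axis j b))
      + integral (cbox (p (2*pi - b)) (\<chi> i. 2 * pi)) (\<lambda>x. f (x + axis j b))"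
    using b by (intro split continuous_on_compose2[OF cont] continuous_intros) auto
  also have "integral (cbox (p (2*pi - b)) (\<chi> i. 2 * pi)) (\<lambda>x. f (x + axis j b))
     = integral (cbox (p (2*pi - b)) (\<chi> i. 2 * pi)) (\<lambda>x. f (x + axis j (b - 2 * pi)))"
    by (simp only: fb)
  also have "\<dots> = integral (cbox (p (2*pi - b) + axis j (b - 2*pi)) ((\<chi> i. 2 * pi) + axis j (b - 2*pi))) f"
    by (rule shift)
  also have "p (2*pi - b) + axis j (b - 2*pi) = 0" by (auto simp: p_def axis_def vec_eq_iff)
  also have "(\<chi> i. 2 * pi) + axis j (b - 2*pi) = q b" by (auto simp: q_def axis_def vec_eq_iff)
  also have "integral (cbox 0 (q (2*pi - b))) (\<lambda>x. f (x + axis j b))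
      = integral (cbox (0 + axis j b) (q (2*pi - b) + axis j b)) f"
    by (rule shift)
  also have "0 + axis j b = p b" by (auto simp: p_def axis_def vec_eq_iff)
  also have "q (2*pi - b) + axis j b = (\<chi> i. 2 * pi)" by (auto simp: q_def axis_def vec_eq_iff)
  also have "integral (cbox (p b) (\<chi> i. 2 * pi)) f + integral (cbox 0 (q b)) f = integral torus_cell f"
    using split[OF cont b] by simp
  finally show ?thesis by (simp add: fa)
qed

text \<open>The vector h is the sum of its axis components, which are removed one at a time;
  shifting by the remaining ones preserves continuity and periodicity.\<close>

lemma integral_torus_cell_shift:
  fixes f :: "real ^ 'n \<Rightarrow> complex"
  assumes "continuous_on UNIV f" and "torus_periodic f"
  shows "integral torus_cell (\<lambda>x. f (x + h)) = integral torus_cell f"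
proof -
  have "integral torus_cell (\<lambda>x. f (x + (\<Sum>j\<in>J. axis j (h $ j)))) = integral torus_cell f"
    if "finite J" for J :: "'n set"
    using that
  proof (induction J)
    case (insert j J)
    let ?S = "\<Sum>j\<in>J. axis j (h $ j)"
    have "integral torus_cell (\<lambda>x. f (x + (\<Sum>j\<in>insert j J. axis j (h $ j))))
        = integral torus_cell (\<lambda>x. f ((x + axis j (h $ j)) + ?S))"
      using insert by (simp add: algebra_simps)
    also have "\<dots> = integral torus_cell (\<lambda>x. f (x + ?S))"
      using assms
      by (intro integral_torus_cell_axis_shift[where f = "\<lambda>x. f (x + ?S)"] torus_periodic_shift
          continuous_on_compose2[OF assms(1)] continuous_intros) auto
    finally show ?case using insert by simp
  qed simp
  moreover have "(\<Sum>j\<in>UNIV. axis j (h $ j)) = h"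
    by (simp add: vec_eq_iff axis_def if_distrib cong: if_cong)
  ultimately show ?thesis by (metis finite)
qed

subsection \<open>Fourier coefficients of the slices\<close>

definition complex_line :: "real ^ 'n \<Rightarrow> real ^ 'n \<Rightarrow> complex \<Rightarrow> complex ^ 'n" where
  "complex_line x y \<zeta> = (\<chi> i. complex_of_real (x $ i) + \<zeta> * complex_of_real (y $ i))"

text \<open>
  The function \<open>z \<mapsto> exp(-i z\<cdot>\<xi>) U(z)\<close> along \<open>z = x + \<zeta>y\<close>. Its integral over \<open>x\<close> in the cell is the
  Fourier coefficient of \<open>U\<^sub>0\<close> at \<open>\<zeta> = 0\<close>, and \<open>exp(y\<cdot>\<xi>)\<close> times that of \<open>U\<^sub>y\<close> at \<open>\<zeta> = \<i>\<close>.
\<close>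

definition twisted_line :: "(complex ^ 'n \<Rightarrow> complex) \<Rightarrow> int ^ 'n \<Rightarrow> real ^ 'n \<Rightarrow> real ^ 'n \<Rightarrow> complex \<Rightarrow> complex"
  where "twisted_line U \<xi> y x \<zeta> =
     exp (- \<i> * (complex_of_real (x \<bullet> freq \<xi>) + \<zeta> * complex_of_real (y \<bullet> freq \<xi>))) * U (complex_line x y \<zeta>)"

lemma complex_line_in_strip: "\<bar>Im \<zeta>\<bar> * norm y < \<sigma> \<Longrightarrow> complex_line x y \<zeta> \<in> strip \<sigma>"
proof -
  assume *: "\<bar>Im \<zeta>\<bar> * norm y < \<sigma>"
  have "(\<chi> i. Im (complex_line x y \<zeta> $ i)) = Im \<zeta> *\<^sub>R y"
    by (simp add: complex_line_def vec_eq_iff)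
  then show ?thesis using * by (simp add: strip_def)
qed

lemma complex_line_add_real:
  "complex_line x y (\<zeta> + of_real t) = complex_line (x + t *\<^sub>R y) y \<zeta>"
  by (simp add: complex_line_def vec_eq_iff algebra_simps)

text \<open>A real change of the parameter only moves the base point within real space, so
  integration over the cell does not see it.\<close>

lemma twisted_line_add_real:
  "twisted_line U \<xi> y x (\<zeta> + of_real t) = twisted_line U \<xi> y (x + t *\<^sub>R y) \<zeta>"
  by (simp add: twisted_line_def complex_line_add_real algebra_simps)

lemma continuous_on_complex_line:
  "continuous_on UNIV (\<lambda>(x, \<zeta>). complex_line x y \<zeta>)"
  unfolding complex_line_def case_prod_unfold
  by (intro continuous_intros)

lemma holomorphic_several_imp_continuous_on:
  "holomorphic_several_on U S \<Longrightarrow> continuous_on S U"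
  unfolding holomorphic_several_on_def
  by (meson continuous_at_imp_continuous_on has_derivative_continuous)

lemma continuous_on_twisted_line:
  assumes "holomorphic_several_on U (strip \<sigma>)"
    and "\<And>p. p \<in> S \<Longrightarrow> \<bar>Im (snd p)\<bar> * norm y < \<sigma>"
  shows "continuous_on S (\<lambda>(x, \<zeta>). twisted_line U \<xi> y x \<zeta>)"
proof -
  have "continuous_on S (\<lambda>p. U (case p of (x, \<zeta>) \<Rightarrow> complex_line x y \<zeta>))"
    by (rule continuous_on_compose2[OF holomorphic_several_imp_continuous_on[OF assms(1)]
          continuous_on_subset[OF continuous_on_complex_line]])
      (use assms(2) in \<open>auto intro!: complex_line_in_strip\<close>)
  then show ?thesis
    unfolding twisted_line_def case_prod_unfold by (intro continuous_intros)
qed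

lemma continuous_on_twisted_line_fst:
  assumes "holomorphic_several_on U (strip \<sigma>)" and "\<bar>Im \<zeta>\<bar> * norm y < \<sigma>"
  shows "continuous_on S (\<lambda>x. twisted_line U \<xi> y x \<zeta>)"
proof -
  have "continuous_on (S \<times> {\<zeta>}) (\<lambda>(x, \<zeta>). twisted_line U \<xi> y x \<zeta>)"
    by (rule continuous_on_twisted_line[OF assms(1)]) (use assms(2) in auto)
  moreover have "continuous_on S (\<lambda>x. (x, \<zeta>))" by (intro continuous_intros)
  ultimately have "continuous_on S (\<lambda>x. case (x, \<zeta>) of (x, \<zeta>) \<Rightarrow> twisted_line U \<xi> y x \<zeta>)"
    by (rule continuous_on_compose2) auto
  then show ?thesis by simp
qed

text \<open>Complex linearity of the total derivative D is what counts: the chain rule along the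
  line gives h \<mapsto> D (h v) = h D v, which is multiplication by a complex number.\<close>

lemma twisted_line_holomorphic_on:
  fixes U :: "complex ^ 'n \<Rightarrow> complex"
  assumes "holomorphic_several_on U (strip \<sigma>)"
  shows "twisted_line U \<xi> y x holomorphic_on {\<zeta>. \<bar>Im \<zeta>\<bar> * norm y < \<sigma>}"
proof -
  have "(\<lambda>\<zeta>. U (complex_line x y \<zeta>)) holomorphic_on {\<zeta>. \<bar>Im \<zeta>\<bar> * norm y < \<sigma>}"
  proof (rule holomorphic_onI)
    fix \<zeta> assume "\<zeta> \<in> {\<zeta>. \<bar>Im \<zeta>\<bar> * norm y < \<sigma>}"
    then have "complex_line x y \<zeta> \<in> strip \<sigma>" by (simp add: complex_line_in_strip)
    then obtain D where D: "(U has_derivative D) (at (complex_line x y \<zeta>))"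
        and lin: "\<And>c v. D (c *s v) = c * D v"
      using assms unfolding holomorphic_several_on_def by blast
    have "((\<lambda>\<zeta>. complex_line x y \<zeta>) has_derivative (\<lambda>h. h *s (\<chi> i. complex_of_real (y $ i)))) (at \<zeta>)"
      unfolding has_derivative_componentwise_within[where f = "complex_line x y"]
    proof
      fix b :: "complex ^ 'n" assume "b \<in> Basis"
      show "((\<lambda>\<zeta>. complex_line x y \<zeta> \<bullet> b) has_derivative
          (\<lambda>h. (h *s (\<chi> i. complex_of_real (y $ i))) \<bullet> b)) (at \<zeta>)"
        unfolding complex_line_def inner_vec_def vector_scalar_mult_def
        by (auto intro!: derivative_eq_intros)
    qed
    from has_derivative_compose[OF this D]
    have "((\<lambda>\<zeta>. U (complex_line x y \<zeta>)) has_derivative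
        (\<lambda>h. h * D (\<chi> i. complex_of_real (y $ i)))) (at \<zeta>)"
      by (simp add: lin)
    moreover have "(\<lambda>h. h * D (\<chi> i. complex_of_real (y $ i))) = (*) (D (\<chi> i. complex_of_real (y $ i)))"
      by (simp add: fun_eq_iff mult.commute)
    ultimately have "((\<lambda>\<zeta>. U (complex_line x y \<zeta>)) has_field_derivative
        D (\<chi> i. complex_of_real (y $ i))) (at \<zeta>)"
      by (simp add: has_field_derivative_def)
    then show "(\<lambda>\<zeta>. U (complex_line x y \<zeta>)) field_differentiable
        (at \<zeta> within {\<zeta>. \<bar>Im \<zeta>\<bar> * norm y < \<sigma>})"
      using field_differentiable_at_within field_differentiable_def by blast
  qed
  then show ?thesis
    unfolding twisted_line_def by (intro holomorphic_intros)
qed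

lemma torus_periodic_twisted_line:
  fixes U :: "complex ^ 'n \<Rightarrow> complex"
  assumes "holomorphic_in_strip \<sigma> U" and "\<bar>Im \<zeta>\<bar> * norm y < \<sigma>"
  shows "torus_periodic (\<lambda>x. twisted_line U \<xi> y x \<zeta>)"
  unfolding torus_periodic_def
proof (intro allI)
  fix x :: "real ^ 'n" and j
  have "complex_line (x + axis j (2*pi)) y \<zeta> = complex_line x y \<zeta> + axis j (complex_of_real (2 * pi))"
    by (simp add: complex_line_def vec_eq_iff axis_def)
  moreover have "complex_line x y \<zeta> \<in> strip \<sigma>" using assms(2) by (rule complex_line_in_strip)
  ultimately have U: "U (complex_line (x + axis j (2*pi)) y \<zeta>) = U (complex_line x y \<zeta>)"
    using assms(1) unfolding holomorphic_in_strip_def by metis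
  \<comment> \<open>The frequencies are integral, so a period in \<open>x\<close> changes the
    exponent by an integer multiple of 2 pi i.\<close>
  have e: "exp (- \<i> * (complex_of_real ((x + axis j (2*pi)) \<bullet> freq \<xi>) + w))
      = exp (- \<i> * (complex_of_real (x \<bullet> freq \<xi>) + w))" for w
  proof -
    have "(x + axis j (2*pi)) \<bullet> freq \<xi> = x \<bullet> freq \<xi> + 2 * pi * real_of_int (\<xi> $ j)"
      by (simp add: inner_add_left inner_axis' freq_def)
    then have "- \<i> * (complex_of_real ((x + axis j (2*pi)) \<bullet> freq \<xi>) + w)
       = - \<i> * (complex_of_real (x \<bullet> freq \<xi>) + w) + complex_of_real (of_int (2 * (- (\<xi> $ j))) * pi) * \<i>"
      by (simp only: of_real_add of_real_mult of_int_mult of_int_minus of_real_minus)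
        (simp add: algebra_simps)
    then show ?thesis
      by (intro iffD2[OF exp_eq] exI)
  qed
  show "twisted_line U \<xi> y (x + axis j (2 * pi)) \<zeta> = twisted_line U \<xi> y x \<zeta>"
    unfolding twisted_line_def U e ..
qed

text \<open>Cauchy's theorem for the unit square. A primitive P exists on the convex set, each side
  integrates to a difference of values of P at corners, and both sides of the equation equal P(1+i)
  - P(i) - P(1) + P(0).\<close>

lemma integral_rectangle_sides:
  fixes f :: "complex \<Rightarrow> complex"
  assumes hol: "f holomorphic_on S" and S: "convex S" "open S"
    and corners: "0 \<in> S" "1 \<in> S" "\<i> \<in> S" "1 + \<i> \<in> S"
  shows "integral {0..1} (\<lambda>t. f (\<i> + of_real t * 1)) - integral {0..1} (\<lambda>t. f (0 + of_real t * 1))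
    = \<i> * integral {0..1} (\<lambda>t. f (1 + of_real t * \<i>)) - \<i> * integral {0..1} (\<lambda>t. f (0 + of_real t * \<i>))"
proof -
  obtain P where P: "\<And>x. x \<in> S \<Longrightarrow> (P has_field_derivative f x) (at x within S)"
    using holomorphic_convex_primitive'[OF S hol] by blast
  have *: "c * integral {0..1} (\<lambda>t. f (a + of_real t * c)) = P (a + c) - P a"
    if "a \<in> S" "a + c \<in> S" for a c
  proof -
    have mem: "a + of_real t * c \<in> S" if "t \<in> {0..1}" for t :: real
    proof -
      have "(1 - t) *\<^sub>R a + t *\<^sub>R (a + c) \<in> S"
        using that \<open>a \<in> S\<close> \<open>a + c \<in> S\<close> S(1) by (intro convexD) auto
      moreover have "(1 - t) *\<^sub>R a + t *\<^sub>R (a + c) = a + of_real t * c"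
        by (simp add: scaleR_conv_of_real algebra_simps)
      ultimately show ?thesis by simp
    qed
    have "((\<lambda>t. f (a + of_real t * c) * c) has_integral
        (P (a + of_real 1 * c) - P (a + of_real 0 * c))) {0..1}"
    proof (rule fundamental_theorem_of_calculus)
      fix t :: real assume t: "t \<in> {0..1}"
      have "(P has_field_derivative f (a + of_real t * c)) (at (a + of_real t * c))"
        using P[OF mem[OF t]] at_within_open[OF mem[OF t] S(2)] by simp
      then have "((\<lambda>z. P (a + z * c)) has_field_derivative f (a + of_real t * c) * c) (at (of_real t))"
        by (rule DERIV_chain2) (auto intro!: derivative_eq_intros)
      then show "((\<lambda>t. P (a + of_real t * c)) has_vector_derivative f (a + of_real t * c) * c)
          (at t within {0..1})"
        by (rule has_vector_derivative_real_field[where f = "\<lambda>z. P (a + z * c)"])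
    qed simp
    from integral_unique[OF this] show ?thesis by (simp add: mult.commute)
  qed
  show ?thesis
    using *[of \<i> 1] *[of 0 1] *[of 1 \<i>] *[of 0 \<i>] corners by (simp add: add.commute)
qed

text \<open>
  Averaging the integral over real translations \<open>\<zeta> + t\<close>, \<open>0 \<le> t \<le> 1\<close>, which do not change it, turns
  the claim into Cauchy's theorem on the unit square; its two vertical sides have equal integrals over
  the cell, again by translation invariance.
\<close>

lemma integral_twisted_line_eq:
  fixes U :: "complex ^ 'n \<Rightarrow> complex"
  assumes hol: "holomorphic_in_strip \<sigma> U" and y: "norm y < \<sigma>"
  shows "integral torus_cell (\<lambda>x. twisted_line U \<xi> y x \<i>)
    = integral torus_cell (\<lambda>x. twisted_line U \<xi> y x 0)"
proof -
  let ?S = "{\<zeta>. \<bar>Im \<zeta>\<bar> * norm y < \<sigma>}"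
  let ?f = "twisted_line U \<xi> y"
  define G where "G \<zeta> = integral torus_cell (\<lambda>x. ?f x \<zeta>)" for \<zeta>
  have \<sigma>: "0 < \<sigma>" using y norm_ge_zero[of y] by linarith
  have several: "holomorphic_several_on U (strip \<sigma>)"
    using hol by (simp add: holomorphic_in_strip_def)
  \<comment> \<open>As the preimage of a ball under a real-linear map the parameter domain is convex
    also for y = 0, when it is the whole plane.\<close>
  have "linear (\<lambda>\<zeta>. Im \<zeta> * norm y)"
    by (rule linearI) (auto simp: algebra_simps)
  then have "convex ((\<lambda>\<zeta>. Im \<zeta> * norm y) -` ball 0 \<sigma>)"
    by (rule convex_linear_vimage) simp
  moreover have "?S = (\<lambda>\<zeta>. Im \<zeta> * norm y) -` ball 0 \<sigma>"
    by (auto simp: abs_mult)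
  ultimately have conv: "convex ?S" by simp
  have opn: "open ?S" by (intro open_Collect_less continuous_intros)
  have G_shift: "G (\<zeta> + of_real t) = G \<zeta>" if "\<zeta> \<in> ?S" for \<zeta> t
  proof -
    have "continuous_on UNIV (\<lambda>x. ?f x \<zeta>)"
      using continuous_on_twisted_line_fst[OF several] that by simp
    from integral_torus_cell_shift[OF this torus_periodic_twisted_line[OF hol], of "t *\<^sub>R y"] that
    show ?thesis by (simp add: G_def twisted_line_add_real)
  qed
  \<comment> \<open>The integral along the segment from a to a + c, without the factor c of the line
    element. Continuity on the compact product of cell and parameter interval permits exchanging it
    with the integral over the cell.\<close>
  define I where "I a c x = integral {0..1} (\<lambda>t. ?f x (a + of_real t * c))" for a c x
  have I: "I a c integrable_on torus_cell"
      "integral torus_cell (I a c) = integral {0..1} (\<lambda>t. G (a + of_real t * c))"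
    if "\<And>t. t \<in> {0..1} \<Longrightarrow> a + of_real t * c \<in> ?S" for a c
  proof -
    have "continuous_on (UNIV \<times> ?S) (\<lambda>(x, \<zeta>). ?f x \<zeta>)"
      by (rule continuous_on_twisted_line[OF several]) auto
    moreover have "continuous_on (torus_cell \<times> {0..1::real})
        (\<lambda>p :: (real ^ 'n) \<times> real. (fst p, a + of_real (snd p) * c))"
      by (intro continuous_intros)
    ultimately have "continuous_on (torus_cell \<times> {0..1})
        (\<lambda>p. case (fst p, a + of_real (snd p) * c) of (x, \<zeta>) \<Rightarrow> ?f x \<zeta>)"
      by (rule continuous_on_compose2) (use that in fastforce)
    then have c: "continuous_on (torus_cell \<times> {0..1}) (\<lambda>(x, t). ?f x (a + of_real t * c))"
      by (simp add: case_prod_unfold)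
    then have c': "continuous_on (cbox (0, 0) ((\<chi> i. 2 * pi), 1)) (\<lambda>(x, t). ?f x (a + of_real t * c))"
      by (simp add: torus_cell_def cbox_Pair_eq)
    show "I a c integrable_on torus_cell"
      unfolding I_def torus_cell_def
      using integral_continuous_on_param[where U = torus_cell and a = 0 and b = "1::real"
          and f = "\<lambda>x t. ?f x (a + of_real t * c)"] c
      by (intro integrable_continuous) (simp add: torus_cell_def)
    show "integral torus_cell (I a c) = integral {0..1} (\<lambda>t. G (a + of_real t * c))"
      using integral_swap_continuous[OF c'] by (simp add: I_def[abs_def] G_def torus_cell_def)
  qed
  have seg: "t \<in> {0..1} \<Longrightarrow> a + of_real t * c \<in> ?S" if "\<bar>Im a\<bar> + \<bar>Im c\<bar> \<le> 1" for a c and t :: real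
  proof -
    assume t: "t \<in> {0..1}"
    have "\<bar>Im a + t * Im c\<bar> \<le> \<bar>Im a\<bar> + \<bar>t\<bar> * \<bar>Im c\<bar>"
      by (metis abs_mult abs_triangle_ineq)
    also have "\<dots> \<le> \<bar>Im a\<bar> + 1 * \<bar>Im c\<bar>"
      using t by (intro add_left_mono mult_right_mono) auto
    finally have "\<bar>Im (a + of_real t * c)\<bar> * norm y \<le> 1 * norm y"
      using that by (intro mult_right_mono) auto
    then show ?thesis using y by simp
  qed
  note Is = I[OF seg]
  have "I \<i> 1 x - I 0 1 x = \<i> * I 1 \<i> x - \<i> * I 0 \<i> x" for x
    unfolding I_def
    by (rule integral_rectangle_sides[OF twisted_line_holomorphic_on[OF several] conv opn])
      (use y \<sigma> in auto)
  then have "integral torus_cell (\<lambda>x. I \<i> 1 x - I 0 1 x)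
      = integral torus_cell (\<lambda>x. \<i> * I 1 \<i> x - \<i> * I 0 \<i> x)" by simp
  then have "integral torus_cell (I \<i> 1) - integral torus_cell (I 0 1)
      = \<i> * integral torus_cell (I 1 \<i>) - \<i> * integral torus_cell (I 0 \<i>)"
    using Is(1) by (simp add: integral_diff integrable_on_mult_right)
  moreover have "integral {0..1} (\<lambda>t. G (\<i> + of_real t * 1)) = G \<i>"
    "integral {0..1} (\<lambda>t. G (0 + of_real t * 1)) = G 0"
    using G_shift[of \<i>] G_shift[of 0] y \<sigma> by simp_all
  moreover have "integral {0..1} (\<lambda>t. G (1 + of_real t * \<i>)) = integral {0..1} (\<lambda>t. G (0 + of_real t * \<i>))"
  proof (rule integral_cong)
    fix t :: real assume "t \<in> {0..1}"
    then show "G (1 + of_real t * \<i>) = G (0 + of_real t * \<i>)"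
      using G_shift[of "of_real t * \<i>" 1] seg[of 0 \<i> t] by (simp add: add.commute)
  qed
  ultimately have "G \<i> = G 0"
    using Is(2)[of \<i> 1] Is(2)[of 0 1] Is(2)[of 1 \<i>] Is(2)[of 0 \<i>] by simp
  then show ?thesis by (simp add: G_def)
qed

lemma fourier_coeff_slice:
  fixes U :: "complex ^ 'n \<Rightarrow> complex"
  assumes hol: "holomorphic_in_strip \<sigma> U" and y: "norm y < \<sigma>"
  shows "fourier_coeff (slice U y) \<xi> = exp (- complex_of_real (y \<bullet> freq \<xi>)) * fourier_coeff (slice U 0) \<xi>"
proof -
  have several: "holomorphic_several_on U (strip \<sigma>)"
    using hol by (simp add: holomorphic_in_strip_def)
  \<comment> \<open>On the imaginary axis \<open>complex_line x y \<zeta>\<close> has imaginary part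
    \<open>Im \<zeta> *\<^sub>R y\<close>, so one computation serves both \<zeta> = i, with factor
    exp(y.\<xi>), and \<zeta> = 0, with factor 1.\<close>
  have coeff: "integral torus_cell (\<lambda>x. twisted_line U \<xi> y x \<zeta>)
      = exp (- \<i> * (\<zeta> * complex_of_real (y \<bullet> freq \<xi>))) * fourier_coeff (slice U (Im \<zeta> *\<^sub>R y)) \<xi>"
    if "\<bar>Im \<zeta>\<bar> * norm y < \<sigma>" "Re \<zeta> = 0" for \<zeta>
  proof -
    have c: "continuous_on torus_cell (\<lambda>x. twisted_line U \<xi> y x \<zeta>)"
      using continuous_on_twisted_line_fst[OF several that(1)] .
    have "integral torus_cell (\<lambda>x. twisted_line U \<xi> y x \<zeta>)
        = (LINT x|lebesgue_on torus_cell. twisted_line U \<xi> y x \<zeta>)"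
      using c unfolding torus_cell_def
      by (intro lebesgue_integral_eq_integral[symmetric] absolutely_integrable_imp_integrable
          absolutely_integrable_continuous) auto
    also have "\<dots> = (LINT x|lebesgue_on torus_cell. exp (- \<i> * (\<zeta> * complex_of_real (y \<bullet> freq \<xi>)))
        * (exp (- \<i> * complex_of_real (x \<bullet> freq \<xi>)) * slice U (Im \<zeta> *\<^sub>R y) x))"
    proof -
      have "complex_line x y \<zeta> = (\<chi> i. Complex (x $ i) ((Im \<zeta> *\<^sub>R y) $ i))" for x
        using that(2) by (simp add: complex_line_def vec_eq_iff complex_eq_iff)
      then show ?thesis
        by (simp add: twisted_line_def slice_def distrib_left exp_add mult_ac exp_diff exp_minus divide_inverse)
    qed
    finally show ?thesis by (simp add: fourier_coeff_def)
  qed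
  have "exp (complex_of_real (y \<bullet> freq \<xi>)) * fourier_coeff (slice U y) \<xi> = fourier_coeff (slice U 0) \<xi>"
    using integral_twisted_line_eq[OF assms, of \<xi>] coeff[of \<i>] coeff[of 0] y norm_ge_zero[of y]
    by (auto simp flip: mult.assoc dest: le_less_trans)
  then show ?thesis
    by (simp add: exp_minus field_simps)
qed

subsection \<open>Weighted sums of Fourier coefficients\<close>

lemma japanese_bracket_ge_1: "1 \<le> japanese_bracket \<xi>"
  by (simp add: japanese_bracket_def)

lemma norm_freq_le_japanese_bracket: "norm (freq \<xi>) \<le> japanese_bracket \<xi>"
  unfolding japanese_bracket_def by (rule real_le_rsqrt) simp

lemma H_term_nonneg: "0 \<le> H_term \<sigma> s u \<xi>"
  by (simp add: H_term_def)

lemma slice_sup_nonneg: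
  assumes "slice_sup_finite \<sigma> s U" and "0 < \<sigma>"
  shows "0 \<le> slice_sup \<sigma> s U"
proof -
  have "0 \<le> Sobolev_norm s (slice U 0)"
    by (simp add: H_norm_def infsum_nonneg H_term_nonneg)
  also have "\<dots> \<le> slice_sup \<sigma> s U"
    using assms unfolding slice_sup_def slice_sup_finite_def by (intro cSUP_upper) auto
  finally show ?thesis .
qed

text \<open>For |y| < \<sigma> the left side is a partial sum of the squared norm of the slice at
  -y. A finite sum is continuous in y, so the bound passes to the sphere |y| = \<sigma>, where there
  is no slice.\<close>

lemma exp_weighted_sum_le_slice_sup:
  fixes U :: "complex ^ 'n \<Rightarrow> complex"
  assumes hol: "holomorphic_in_strip \<sigma> U" and fin: "slice_sup_finite \<sigma> s U"
    and "0 < \<sigma>" and y: "norm y \<le> \<sigma>" and F: "finite F"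
  shows "(\<Sum>\<xi>\<in>F. exp (2 * (y \<bullet> freq \<xi>)) * H_term 0 s (slice U 0) \<xi>) \<le> (slice_sup \<sigma> s U)\<^sup>2"
proof -
  let ?g = "\<lambda>y. \<Sum>\<xi>\<in>F. exp (2 * (y \<bullet> freq \<xi>)) * H_term 0 s (slice U 0) \<xi>"
  have "?g y \<le> (slice_sup \<sigma> s U)\<^sup>2" if "y \<in> ball 0 \<sigma>" for y
  proof -
    have y: "norm (- y) < \<sigma>" using that by simp
    have "H_term 0 s (slice U (- y)) \<xi> = exp (2 * (y \<bullet> freq \<xi>)) * H_term 0 s (slice U 0) \<xi>" for \<xi>
      unfolding H_term_def fourier_coeff_slice[OF hol y]
      by (simp add: norm_mult power_mult_distrib exp_double)
    then have "?g y = (\<Sum>\<xi>\<in>F. H_term 0 s (slice U (- y)) \<xi>)" by simp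
    also have "\<dots> \<le> (\<Sum>\<^sub>\<infinity>\<xi>. H_term 0 s (slice U (- y)) \<xi>)"
      using fin y F unfolding slice_sup_finite_def H_space_def
      by (intro finite_sum_le_infsum) (auto simp: H_term_nonneg)
    also have "\<dots> = (Sobolev_norm s (slice U (- y)))\<^sup>2"
      by (simp add: H_norm_def infsum_nonneg H_term_nonneg)
    also have "\<dots> \<le> (slice_sup \<sigma> s U)\<^sup>2"
    proof (rule power_mono)
      show "Sobolev_norm s (slice U (- y)) \<le> slice_sup \<sigma> s U"
        using fin y unfolding slice_sup_def slice_sup_finite_def by (intro cSUP_upper) auto
    qed (simp add: H_norm_def infsum_nonneg H_term_nonneg)
    finally show ?thesis .
  qed
  moreover have "continuous_on (closure (ball 0 \<sigma>)) ?g" by (intro continuous_intros)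
  moreover have "y \<in> closure (ball 0 \<sigma>)" using y \<open>0 < \<sigma>\<close> by simp
  ultimately show ?thesis by (rule continuous_le_on_closure[rotated 2])
qed

text \<open>The radial weight at each frequency is dominated by one exponential of the net, hence by
  the sum over all of \<open>Y\<close>; exchanging the sums costs one slice bound per net
  point.\<close>

lemma sum_H_term_le_net:
  fixes U :: "complex ^ 'n \<Rightarrow> complex"
  assumes hol: "holomorphic_in_strip \<sigma> U" and fin: "slice_sup_finite \<sigma> s U" and "0 < \<sigma>"
    and Y: "finite Y" "\<And>y. y \<in> Y \<Longrightarrow> norm y \<le> \<sigma>" and F: "finite F" and K: "0 \<le> K"
    and net: "\<And>\<xi>. \<xi> \<in> F \<Longrightarrow> \<exists>y\<in>Y. exp (2 * \<tau> * norm (freq \<xi>)) \<le> K * exp (2 * (y \<bullet> freq \<xi>))"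
  shows "sum (H_term \<tau> s (slice U 0)) F \<le> K * real (card Y) * (slice_sup \<sigma> s U)\<^sup>2"
proof -
  let ?h = "H_term 0 s (slice U 0)"
  have "sum (H_term \<tau> s (slice U 0)) F
      \<le> (\<Sum>\<xi>\<in>F. \<Sum>y\<in>Y. K * (exp (2 * (y \<bullet> freq \<xi>)) * ?h \<xi>))"
  proof (rule sum_mono)
    fix \<xi> assume "\<xi> \<in> F"
    then obtain y where y: "y \<in> Y" "exp (2 * \<tau> * norm (freq \<xi>)) \<le> K * exp (2 * (y \<bullet> freq \<xi>))"
      using net by blast
    have "H_term \<tau> s (slice U 0) \<xi> = exp (2 * \<tau> * norm (freq \<xi>)) * ?h \<xi>"
      by (simp add: H_term_def)
    also have "\<dots> \<le> K * exp (2 * (y \<bullet> freq \<xi>)) * ?h \<xi>"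
      using y(2) by (intro mult_right_mono H_term_nonneg)
    also have "\<dots> = (\<Sum>y\<in>{y}. K * (exp (2 * (y \<bullet> freq \<xi>)) * ?h \<xi>))"
      by simp
    also have "\<dots> \<le> (\<Sum>y\<in>Y. K * (exp (2 * (y \<bullet> freq \<xi>)) * ?h \<xi>))"
      using y(1) Y(1) K by (intro sum_mono2) (auto simp: H_term_nonneg)
    finally show "H_term \<tau> s (slice U 0) \<xi> \<le> (\<Sum>y\<in>Y. K * (exp (2 * (y \<bullet> freq \<xi>)) * ?h \<xi>))" .
  qed
  also have "\<dots> = (\<Sum>y\<in>Y. K * (\<Sum>\<xi>\<in>F. exp (2 * (y \<bullet> freq \<xi>)) * ?h \<xi>))"
    by (subst sum.swap) (simp add: sum_distrib_left)
  also have "\<dots> \<le> (\<Sum>y\<in>Y. K * (slice_sup \<sigma> s U)\<^sup>2)"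
    using exp_weighted_sum_le_slice_sup[OF hol fin \<open>0 < \<sigma>\<close> Y(2) F] K
    by (intro sum_mono mult_left_mono) auto
  finally show ?thesis by (simp add: mult_ac)
qed

text \<open>Bounding the finite partial sums yields summability first; a bound on the infinite sum
  alone would say nothing, as a divergent one has value 0.\<close>

lemma H_space_of_sum_bound:
  assumes "u \<in> L2_torus" and "0 \<le> B"
    and le: "\<And>F. finite F \<Longrightarrow> sum (H_term \<sigma> s u) F \<le> B\<^sup>2"
  shows "u \<in> H_space \<sigma> s" and "H_norm \<sigma> s u \<le> B"
proof -
  have summ: "H_term \<sigma> s u summable_on UNIV"
    using le by (intro nonneg_bdd_above_summable_on) (auto simp: H_term_nonneg bdd_above_def)
  then show "u \<in> H_space \<sigma> s" using assms(1) by (simp add: H_space_def)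
  have "(\<Sum>\<^sub>\<infinity>\<xi>. H_term \<sigma> s u \<xi>) \<le> B\<^sup>2"
    using summ le by (intro infsum_le_finite_sums)
  then show "H_norm \<sigma> s u \<le> B"
    unfolding H_norm_def using \<open>0 \<le> B\<close> by (simp add: real_le_lsqrt infsum_nonneg H_term_nonneg)
qed

lemma slice_zero_L2_torus: "slice_sup_finite \<sigma> s U \<Longrightarrow> 0 < \<sigma> \<Longrightarrow> slice U 0 \<in> L2_torus"
  by (simp add: slice_sup_finite_def H_space_def)

section \<open>A net of directions on the sphere\<close>

text \<open>
  Grid points on the surface of the cube \<open>[-1,1]^d\<close>; normalised, they form a net of about \<open>m^(d-1)\<close>
  directions on the sphere.
\<close>

definition cube_grid :: "nat \<Rightarrow> (real ^ 'n) set" where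
  "cube_grid m = (\<Union>i. {w. w $ i \<in> {-1, 1} \<and>
     (\<forall>j. j \<noteq> i \<longrightarrow> w $ j \<in> (\<lambda>k. real_of_int k / real m) ` {- int m..int m})})"

text \<open>There are d choices of the face coordinate, 2 values for it and at most 2m + 1 for each
  of the other d - 1 coordinates.\<close>

lemma cube_grid:
  shows finite_cube_grid: "finite (cube_grid m :: (real ^ 'n) set)"
    and card_cube_grid: "card (cube_grid m :: (real ^ 'n) set) \<le> CARD('n) * (2 * (2 * m + 1) ^ (CARD('n) - 1))"
proof -
  define T where "T i j = (if j = i then {-1, 1} else (\<lambda>k. real_of_int k / real m) ` {- int m..int m})"
    for i j :: 'n
  define A where "A i = vec_lambda ` (\<Pi>\<^sub>E j\<in>UNIV. T i j)" for i :: 'n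
  have finT: "finite (T i j)" for i j by (simp add: T_def)
  have finA: "finite (A i)" for i unfolding A_def by (intro finite_imageI finite_PiE finT) auto
  have cT: "card (T i j) \<le> (if j = i then 2 else 2 * m + 1)" for i j
  proof -
    have "card ((\<lambda>k. real_of_int k / real m) ` {- int m..int m}) \<le> card {- int m..int m}"
      by (rule card_image_le) simp
    also have "\<dots> = 2 * m + 1" by (simp add: nat_eq_iff)
    finally show ?thesis by (simp add: T_def)
  qed
  have cA: "card (A i) \<le> 2 * (2 * m + 1) ^ (CARD('n) - 1)" for i
  proof -
    have "card (A i) \<le> card (\<Pi>\<^sub>E j\<in>UNIV. T i j)"
      unfolding A_def by (intro card_image_le finite_PiE finT) auto
    also have "\<dots> = (\<Prod>j\<in>UNIV. card (T i j))" by (simp add: card_PiE)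
    also have "\<dots> \<le> (\<Prod>j\<in>UNIV. if j = i then 2 else 2 * m + 1)"
      by (intro prod_mono) (use cT in auto)
    also have "\<dots> = 2 * (\<Prod>j\<in>UNIV - {i}. 2 * m + 1)"
      by (subst prod.remove[of UNIV i]) auto
    finally show ?thesis by (simp add: card_Diff_singleton)
  qed
  have eq: "cube_grid m = (\<Union>i. A i)"
  proof -
    let ?W = "\<lambda>i. {w. w $ i \<in> {-1, 1} \<and>
      (\<forall>j. j \<noteq> i \<longrightarrow> w $ j \<in> (\<lambda>k. real_of_int k / real m) ` {- int m..int m})}"
    have "?W i = A i" for i
    proof (intro equalityI subsetI)
      fix w assume "w \<in> ?W i"
      then have "vec_nth w \<in> (\<Pi>\<^sub>E j\<in>UNIV. T i j)" by (auto simp: T_def)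
      then have "vec_lambda (vec_nth w) \<in> A i" unfolding A_def by (rule imageI)
      then show "w \<in> A i" by simp
    next
      fix w assume "w \<in> A i"
      then obtain g where g: "g \<in> (\<Pi>\<^sub>E j\<in>UNIV. T i j)" "w = vec_lambda g" by (auto simp: A_def)
      have gT: "g j \<in> T i j" for j using g(1) by auto
      have "g i \<in> {-1, 1}" using gT[of i] by (simp add: T_def)
      moreover have "g j \<in> (\<lambda>k. real_of_int k / real m) ` {- int m..int m}" if "j \<noteq> i" for j
        using gT[of j] that by (simp add: T_def)
      ultimately show "w \<in> ?W i"
        using g(2) by simp
    qed
    then show ?thesis by (simp add: cube_grid_def)
  qed
  show "finite (cube_grid m :: (real ^ 'n) set)" using finA eq by simp
  have "card (cube_grid m :: (real ^ 'n) set) \<le> (\<Sum>i\<in>UNIV. card (A i))"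
    unfolding eq by (rule card_UN_le) simp
  also have "\<dots> \<le> (\<Sum>i\<in>(UNIV :: 'n set). 2 * (2 * m + 1) ^ (CARD('n) - 1))"
    by (intro sum_mono cA)
  finally show "card (cube_grid m :: (real ^ 'n) set) \<le> CARD('n) * (2 * (2 * m + 1) ^ (CARD('n) - 1))"
    by simp
qed

lemma norm_ge_1_of_coordinate: "\<bar>v $ i\<bar> = 1 \<Longrightarrow> 1 \<le> norm v" for v :: "real ^ 'n"
  using component_le_norm_cart[of v i] by simp

text \<open>Scale x to a point v on the surface of the cube and round all but the extremal
  coordinate down to the grid, giving w on the same face with |v - w|^2 \<le> d/m^2. The identity 2
  v.w = |v|^2 + |w|^2 - |v - w|^2 then compares v.w with |v| |w|.\<close>

lemma cube_grid_direction:
  fixes x :: "real ^ 'n"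
  assumes "1 \<le> m"
  obtains w where "w \<in> cube_grid m"
    "norm x * (1 - real CARD('n) / (2 * (real m)\<^sup>2)) \<le> sgn w \<bullet> x"
proof (cases "x = 0")
  case True
  \<comment> \<open>For x = 0 the inequality is trivial and any grid point will do.\<close>
  have "(\<chi> i. 1) \<in> (cube_grid m :: (real ^ 'n) set)"
    unfolding cube_grid_def using assms by (force simp: image_iff intro: bexI[of _ "int m"])
  then show ?thesis using True that by simp
next
  case False
  obtain i where i: "\<And>j. \<bar>x $ j\<bar> \<le> \<bar>x $ i\<bar>"
  proof -
    have "Max (range (\<lambda>j. \<bar>x $ j\<bar>)) \<in> range (\<lambda>j. \<bar>x $ j\<bar>)" by (intro Max_in) auto
    then obtain i where "\<bar>x $ i\<bar> = Max (range (\<lambda>j. \<bar>x $ j\<bar>))" by force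
    then show ?thesis using that by (metis Max_ge finite finite_imageI rangeI)
  qed
  define r where "r = \<bar>x $ i\<bar>"
  have r: "0 < r"
  proof -
    obtain j where "x $ j \<noteq> 0" using False by (auto simp: vec_eq_iff)
    then show ?thesis using i[of j] by (auto simp: r_def)
  qed
  define v where "v = x /\<^sub>R r"
  have x: "x = r *\<^sub>R v" using r by (simp add: v_def)
  have vi: "v $ i \<in> {-1, 1}" using r by (auto simp: v_def r_def divide_simps abs_if split: if_splits)
  have vj: "\<bar>v $ j\<bar> \<le> 1" for j
    using i[of j] r by (simp add: v_def r_def abs_mult divide_simps)
  define w :: "real ^ 'n" where "w = (\<chi> j. if j = i then v $ i else real_of_int \<lfloor>real m * v $ j\<rfloor> / real m)"
  have m: "0 < real m" using assms by simp
  have w: "w \<in> cube_grid m"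
  proof -
    have "\<lfloor>real m * v $ j\<rfloor> \<in> {- int m..int m}" for j
    proof -
      have "\<bar>real m * v $ j\<bar> \<le> real m"
        using mult_left_mono[OF vj, of "real m" j] by (simp add: abs_mult)
      then have "- real m \<le> real m * v $ j" "real m * v $ j \<le> real m" by auto
      then show ?thesis by (simp add: le_floor_iff floor_le_iff)
    qed
    then have "w $ i \<in> {-1, 1} \<and> (\<forall>j. j \<noteq> i \<longrightarrow> w $ j \<in> (\<lambda>k. real_of_int k / real m) ` {- int m..int m})"
      using vi unfolding w_def by auto
    then show ?thesis unfolding cube_grid_def by blast
  qed
  have diff: "\<bar>(v - w) $ j\<bar> \<le> 1 / real m" for j
  proof (cases "j = i")
    case False
    have "(v - w) $ j = frac (real m * v $ j) / real m"
      using False m by (simp add: w_def frac_def field_simps)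
    then show ?thesis
      using m frac_lt_1[of "real m * v $ j"] by (simp add: divide_right_mono)
  qed (simp add: w_def)
  have "(norm (v - w))\<^sup>2 = (\<Sum>j\<in>UNIV. ((v - w) $ j)\<^sup>2)"
    unfolding norm_vec_def L2_set_def by (simp add: sum_nonneg)
  also have "\<dots> \<le> (\<Sum>j\<in>(UNIV :: 'n set). (1 / real m)\<^sup>2)"
    using diff by (intro sum_mono) (metis abs_ge_zero power2_abs power_mono)
  finally have d: "(norm (v - w))\<^sup>2 \<le> real CARD('n) / (real m)\<^sup>2"
    by (simp add: power_divide)
  have nv: "1 \<le> norm v" and nw: "1 \<le> norm w"
    using vi by (auto intro!: norm_ge_1_of_coordinate[of _ i] simp: w_def)
  \<comment> \<open>The angular error enters quadratically, whence the factor \<open>1/m\<^sup>2\<close>.\<close>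
  have "norm v * norm w - (norm (v - w))\<^sup>2 / 2 \<le> v \<bullet> w"
  proof -
    have "(norm (v - w))\<^sup>2 = (norm v)\<^sup>2 + (norm w)\<^sup>2 - 2 * (v \<bullet> w)"
      by (simp add: power2_norm_eq_inner inner_diff inner_commute)
    moreover have "2 * (norm v * norm w) \<le> (norm v)\<^sup>2 + (norm w)\<^sup>2"
      using sum_squares_bound[of "norm v" "norm w"] by (simp add: mult.assoc)
    ultimately show ?thesis by linarith
  qed
  then have "norm v * norm w - real CARD('n) / (2 * (real m)\<^sup>2) \<le> v \<bullet> w"
    using d by (simp add: field_simps)
  \<comment> \<open>Both norms are at least 1, since one coordinate is 1 or -1; this turns the
    absolute error into a relative one.\<close>
  moreover have "1 * real CARD('n) / (2 * (real m)\<^sup>2) \<le> (norm v * norm w) * (real CARD('n) / (2 * (real m)\<^sup>2))"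
    using mult_right_mono[OF mult_mono[OF nv nw], of "real CARD('n) / (2 * (real m)\<^sup>2)"] by simp
  ultimately have "norm w * (norm v * (1 - real CARD('n) / (2 * (real m)\<^sup>2))) \<le> v \<bullet> w"
    by (simp add: algebra_simps)
  then have "norm v * (1 - real CARD('n) / (2 * (real m)\<^sup>2)) \<le> (v \<bullet> w) / norm w"
    using nw by (subst pos_le_divide_eq) (auto simp: mult.commute)
  also have "\<dots> = sgn w \<bullet> v" by (simp add: sgn_div_norm inner_commute divide_inverse mult.commute)
  finally have "r * (norm v * (1 - real CARD('n) / (2 * (real m)\<^sup>2))) \<le> r * (sgn w \<bullet> v)"
    using r by simp
  then have "norm x * (1 - real CARD('n) / (2 * (real m)\<^sup>2)) \<le> sgn w \<bullet> x"
    using r by (simp add: x)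
  then show ?thesis using w that by blast
qed

subsection \<open>Summation over shells\<close>

text \<open>The net consists of the grid directions scaled to length \<sigma>. The number c is the
  loss allowed in the exponent and becomes the factor \<open>exp c\<close>.\<close>

lemma sum_H_term_le_cube_grid:
  fixes U :: "complex ^ 'n \<Rightarrow> complex"
  assumes hol: "holomorphic_in_strip \<sigma> U" and fin: "slice_sup_finite \<sigma> s U" and \<sigma>: "0 < \<sigma>"
    and m: "1 \<le> m" and F: "finite F"
    and le: "\<And>\<xi>. \<xi> \<in> F \<Longrightarrow> 2 * \<tau> * norm (freq \<xi>)
        \<le> c + 2 * \<sigma> * (norm (freq \<xi>) * (1 - real CARD('n) / (2 * (real m)\<^sup>2)))"
  shows "sum (H_term \<tau> s (slice U 0)) F
    \<le> exp c * real (card (cube_grid m :: (real ^ 'n) set)) * (slice_sup \<sigma> s U)\<^sup>2"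
proof -
  let ?Y = "(\<lambda>w. \<sigma> *\<^sub>R sgn w) ` (cube_grid m :: (real ^ 'n) set)"
  have "sum (H_term \<tau> s (slice U 0)) F \<le> exp c * real (card ?Y) * (slice_sup \<sigma> s U)\<^sup>2"
  proof (rule sum_H_term_le_net[OF hol fin \<sigma> _ _ F])
    show "finite ?Y" by (simp add: finite_cube_grid)
    show "norm y \<le> \<sigma>" if "y \<in> ?Y" for y
      using that \<sigma> by (auto simp: norm_sgn)
    fix \<xi> assume \<xi>: "\<xi> \<in> F"
    obtain w where w: "w \<in> cube_grid m"
      "norm (freq \<xi>) * (1 - real CARD('n) / (2 * (real m)\<^sup>2)) \<le> sgn w \<bullet> freq \<xi>"
      using cube_grid_direction[OF m] by blast
    have "2 * \<tau> * norm (freq \<xi>) \<le> c + 2 * \<sigma> * (sgn w \<bullet> freq \<xi>)"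
      using le[OF \<xi>] mult_left_mono[OF w(2), of "2 * \<sigma>"] \<sigma> by linarith
    then have "exp (2 * \<tau> * norm (freq \<xi>)) \<le> exp c * exp (2 * ((\<sigma> *\<^sub>R sgn w) \<bullet> freq \<xi>))"
      by (simp flip: exp_add add: mult.assoc)
    then show "\<exists>y\<in>?Y. exp (2 * \<tau> * norm (freq \<xi>)) \<le> exp c * exp (2 * (y \<bullet> freq \<xi>))"
      using w(1) by blast
  qed simp
  \<comment> \<open>Different grid points may share a direction, so the net is only bounded by the
    size of the grid.\<close>
  also have "\<dots> \<le> exp c * real (card (cube_grid m :: (real ^ 'n) set)) * (slice_sup \<sigma> s U)\<^sup>2"
    by (intro mult_right_mono mult_left_mono) (auto intro: card_image_le finite_cube_grid)
  finally show ?thesis .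
qed

section \<open>Dimension one and smaller widths: a fixed net\<close>

lemma H_norm_slice_le_one_dim:
  fixes U :: "complex ^ 'n \<Rightarrow> complex"
  assumes "CARD('n) = 1" and \<sigma>: "0 < \<sigma>"
    and hol: "holomorphic_in_strip \<sigma> U" and fin: "slice_sup_finite \<sigma> s U"
  shows "slice U 0 \<in> H_space \<sigma> s \<and> H_norm \<sigma> s (slice U 0) \<le> 2 * slice_sup \<sigma> s U"
proof -
  obtain i :: 'n where i: "UNIV = {i}" using assms(1) by (rule card_1_singletonE)
  have norm1: "norm x = \<bar>x $ i\<bar>" for x :: "real ^ 'n"
    by (simp add: norm_vec_def L2_set_def i)
  have "sum (H_term \<sigma> s (slice U 0)) F \<le> (2 * slice_sup \<sigma> s U)\<^sup>2" if F: "finite F" for F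
  proof -
    let ?Y = "{axis i \<sigma>, axis i (- \<sigma>)} :: (real ^ 'n) set"
    have "sum (H_term \<sigma> s (slice U 0)) F \<le> 1 * real (card ?Y) * (slice_sup \<sigma> s U)\<^sup>2"
    proof (rule sum_H_term_le_net[OF hol fin \<sigma> _ _ F])
      show "norm y \<le> \<sigma>" if "y \<in> ?Y" for y using that \<sigma> by (auto simp: norm1)
      \<comment> \<open>The sign of the frequency selects the net point, without any loss.\<close>
      show "\<exists>y\<in>?Y. exp (2 * \<sigma> * norm (freq \<xi>)) \<le> 1 * exp (2 * (y \<bullet> freq \<xi>))" for \<xi>
        by (auto simp: norm1 inner_axis' abs_if)
    qed auto
    \<comment> \<open>Two net points give at most a factor 2, bounded by 4 = 2^2 to match the
      constant 2 for the norm.\<close>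
    also have "\<dots> \<le> 4 * (slice_sup \<sigma> s U)\<^sup>2"
      by (intro mult_right_mono) (auto simp: card_insert_if)
    finally show ?thesis by (simp add: power_mult_distrib)
  qed
  then show ?thesis
    using H_space_of_sum_bound[OF slice_zero_L2_torus[OF fin \<sigma>], where B = "2 * slice_sup \<sigma> s U"]
        slice_sup_nonneg[OF fin \<sigma>] by simp
qed

lemma ex_H_norm_slice_bound_smaller_width:
  fixes \<sigma> \<delta> s :: real
  assumes \<sigma>: "0 < \<sigma>" and "\<delta> < \<sigma>"
  shows "\<exists>C>0. \<forall>U :: complex ^ 'n \<Rightarrow> complex.
    holomorphic_in_strip \<sigma> U \<and> slice_sup_finite \<sigma> s U \<longrightarrow>
      slice U 0 \<in> H_space \<delta> s \<and> H_norm \<delta> s (slice U 0) \<le> C * slice_sup \<sigma> s U"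
proof -
  define d where "d = real CARD('n)"
  \<comment> \<open>The relative loss d/(2m^2) must fit into the gap: \<sigma> d/(2m^2) \<le>
    \<sigma> - \<delta>. As m \<le> m^2, the linear condition on m suffices. Then the exponent loss
    in the grid bound is c = 0.\<close>
  obtain m :: nat where m: "1 \<le> m" "\<sigma> * d / (2 * (\<sigma> - \<delta>)) \<le> real m"
  proof -
    obtain n :: nat where "\<sigma> * d / (2 * (\<sigma> - \<delta>)) \<le> real n" using real_arch_simple by blast
    then show ?thesis using that[of "Suc n"] by simp
  qed
  have "\<sigma> * d \<le> real m * (2 * (\<sigma> - \<delta>))"
    using m(2) \<open>\<delta> < \<sigma>\<close> by (simp add: pos_divide_le_eq)
  also have "\<dots> \<le> (real m)\<^sup>2 * (2 * (\<sigma> - \<delta>))"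
    using m(1) \<open>\<delta> < \<sigma>\<close> by (intro mult_right_mono) (auto simp: power2_eq_square)
  finally have "\<sigma> * d \<le> (\<sigma> - \<delta>) * (2 * (real m)\<^sup>2)" by (simp only: mult_ac)
  then have "\<sigma> * d / (2 * (real m)\<^sup>2) \<le> \<sigma> - \<delta>"
    using m(1) by (subst pos_divide_le_eq) auto
  then have \<delta>: "\<delta> \<le> \<sigma> * (1 - d / (2 * (real m)\<^sup>2))"
    by (simp add: algebra_simps)
  \<comment> \<open>The summand 1 makes the constant visibly positive.\<close>
  define B where "B = real (card (cube_grid m :: (real ^ 'n) set)) + 1"
  have B: "0 < B" by (simp add: B_def)
  have "slice U 0 \<in> H_space \<delta> s \<and> H_norm \<delta> s (slice U 0) \<le> sqrt B * slice_sup \<sigma> s U"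
    if hol: "holomorphic_in_strip \<sigma> U" and fin: "slice_sup_finite \<sigma> s U"
    for U :: "complex ^ 'n \<Rightarrow> complex"
  proof -
    have "sum (H_term \<delta> s (slice U 0)) F \<le> (sqrt B * slice_sup \<sigma> s U)\<^sup>2" if F: "finite F" for F
    proof -
      have "sum (H_term \<delta> s (slice U 0)) F
        \<le> exp 0 * real (card (cube_grid m :: (real ^ 'n) set)) * (slice_sup \<sigma> s U)\<^sup>2"
      proof (rule sum_H_term_le_cube_grid[OF hol fin \<sigma> m(1) F])
        fix \<xi> :: "int ^ 'n"
        have "norm (freq \<xi>) * \<delta> \<le> norm (freq \<xi>) * (\<sigma> * (1 - d / (2 * (real m)\<^sup>2)))"
          using \<delta> by (intro mult_left_mono) auto
        then have "2 * (norm (freq \<xi>) * \<delta>) \<le> 2 * (norm (freq \<xi>) * (\<sigma> * (1 - d / (2 * (real m)\<^sup>2))))"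
          by (rule mult_left_mono) simp
        then show "2 * \<delta> * norm (freq \<xi>) \<le> 0 + 2 * \<sigma> * (norm (freq \<xi>) * (1 - real CARD('n) / (2 * (real m)\<^sup>2)))"
          by (simp only: d_def mult_ac add_0_left)
      qed
      also have "\<dots> \<le> B * (slice_sup \<sigma> s U)\<^sup>2"
        by (intro mult_right_mono) (auto simp: B_def)
      finally show ?thesis using B by (simp add: power_mult_distrib)
    qed
    then show ?thesis
      using H_space_of_sum_bound[OF slice_zero_L2_torus[OF fin \<sigma>], where B = "sqrt B * slice_sup \<sigma> s U"]
        slice_sup_nonneg[OF fin \<sigma>] B by simp
  qed
  then show ?thesis using B by (intro exI[of _ "sqrt B"]) auto
qed

section \<open>The full width: summation over shells\<close>

lemma japanese_bracket_shell:
  obtains k :: nat where "4 ^ k \<le> japanese_bracket \<xi>" "japanese_bracket \<xi> < 4 ^ Suc k"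
proof -
  have ge: "1 \<le> japanese_bracket \<xi>" by (rule japanese_bracket_ge_1)
  \<comment> \<open>The least such exponent is nonzero because the bracket is at least 1 = 4^0; its
    predecessor is the index of the shell.\<close>
  obtain n where "japanese_bracket \<xi> < 4 ^ n" using real_arch_pow[of 4] by auto
  then have L: "japanese_bracket \<xi> < 4 ^ (LEAST n. japanese_bracket \<xi> < 4 ^ n)" by (rule LeastI)
  then have "(LEAST n. japanese_bracket \<xi> < 4 ^ n) \<noteq> 0" using ge by (metis not_less power_0)
  then obtain k where k: "(LEAST n. japanese_bracket \<xi> < 4 ^ n) = Suc k" using not0_implies_Suc by blast
  then have "\<not> japanese_bracket \<xi> < 4 ^ k" using not_less_Least[of k "\<lambda>n. japanese_bracket \<xi> < 4 ^ n"] by auto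
  then show ?thesis using that[of k] L k by simp
qed

text \<open>The grid bound is applied with exponent s' and m = 2^k, so that m^2 = 4^k matches the
  size of the frequencies. Passing from s' to s afterwards gains 2^(-4(s'-s)k), against about
  2^(k(d-1)) grid points.\<close>

lemma sum_H_term_shell_le:
  fixes U :: "complex ^ 'n \<Rightarrow> complex"
  assumes hol: "holomorphic_in_strip \<sigma> U" and fin: "slice_sup_finite \<sigma> s' U" and \<sigma>: "0 < \<sigma>"
    and F: "finite F" and "s \<le> s'"
    and shell: "\<And>\<xi>. \<xi> \<in> F \<Longrightarrow> 4 ^ k \<le> japanese_bracket \<xi> \<and> japanese_bracket \<xi> < 4 ^ Suc k"
  shows "sum (H_term \<sigma> s (slice U 0)) F
    \<le> exp (4 * \<sigma> * real CARD('n)) * (2 * real CARD('n) * 3 ^ (CARD('n) - 1))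
        * (2 powr (real CARD('n) - 1 - 4 * (s' - s))) ^ k * (slice_sup \<sigma> s' U)\<^sup>2"
proof -
  let ?d = "CARD('n)" and ?u = "slice U 0" and ?M = "(slice_sup \<sigma> s' U)\<^sup>2"
  let ?N = "real (card (cube_grid (2 ^ k) :: (real ^ 'n) set))"
  let ?q = "2 powr (- 4 * (s' - s) * real k)"
  have "sum (H_term \<sigma> s' ?u) F \<le> exp (4 * \<sigma> * real ?d) * ?N * ?M"
  proof (rule sum_H_term_le_cube_grid[OF hol fin \<sigma> _ F])
    fix \<xi> assume \<xi>: "\<xi> \<in> F"
    \<comment> \<open>The upper end 4 * 4^k of the shell bounds the exponent loss \<sigma> d |\<xi>|
      / 4^k by 4 \<sigma> d.\<close>
    have "norm (freq \<xi>) \<le> 4 * 4 ^ k"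
      using norm_freq_le_japanese_bracket[of \<xi>] shell[OF \<xi>] by simp
    moreover have "(real (2 ^ k))\<^sup>2 = 4 ^ k" by (simp add: power2_eq_square flip: power_mult_distrib)
    ultimately have "norm (freq \<xi>) / (real (2 ^ k))\<^sup>2 \<le> 4" by (simp add: divide_le_eq)
    then have "\<sigma> * real ?d * (norm (freq \<xi>) / (real (2 ^ k))\<^sup>2) \<le> \<sigma> * real ?d * 4"
      using \<sigma> by (intro mult_left_mono) auto
    moreover have "2 * \<sigma> * (norm (freq \<xi>) * (1 - real ?d / (2 * (real (2 ^ k))\<^sup>2)))
        = 2 * \<sigma> * norm (freq \<xi>) - \<sigma> * real ?d * (norm (freq \<xi>) / (real (2 ^ k))\<^sup>2)"
      by (simp add: field_simps)
    ultimately show "2 * \<sigma> * norm (freq \<xi>) \<le> 4 * \<sigma> * real ?d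
        + 2 * \<sigma> * (norm (freq \<xi>) * (1 - real ?d / (2 * (real (2 ^ k))\<^sup>2)))"
      by linarith
  qed simp
  also have "\<dots> \<le> exp (4 * \<sigma> * real ?d) * (2 * real ?d * 3 ^ (?d - 1) * (2 ^ k) ^ (?d - 1)) * ?M"
  proof (intro mult_right_mono mult_left_mono)
    have "card (cube_grid (2 ^ k) :: (real ^ 'n) set) \<le> ?d * (2 * (2 * 2 ^ k + 1) ^ (?d - 1))"
      by (rule card_cube_grid)
    \<comment> \<open>Here 2 * 2^k + 1 \<le> 3 * 2^k.\<close>
    also have "\<dots> \<le> ?d * (2 * (3 * 2 ^ k) ^ (?d - 1))"
      by (intro mult_le_mono power_mono order_refl) auto
    finally have "?N \<le> real (?d * (2 * (3 * 2 ^ k) ^ (?d - 1)))" by (simp only: of_nat_le_iff)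
    then show "?N \<le> 2 * real ?d * 3 ^ (?d - 1) * (2 ^ k) ^ (?d - 1)"
      by (simp add: power_mult_distrib mult_ac)
  qed auto
  finally have le: "sum (H_term \<sigma> s' ?u) F
    \<le> exp (4 * \<sigma> * real ?d) * (2 * real ?d * 3 ^ (?d - 1) * (2 ^ k) ^ (?d - 1)) * ?M" .
  have "sum (H_term \<sigma> s ?u) F \<le> (\<Sum>\<xi>\<in>F. ?q * H_term \<sigma> s' ?u \<xi>)"
  proof (rule sum_mono)
    fix \<xi> assume \<xi>: "\<xi> \<in> F"
    let ?b = "japanese_bracket \<xi>"
    have "?b powr (2 * s) = ?b powr (- (2 * (s' - s))) * ?b powr (2 * s')"
      by (simp flip: powr_add)
    \<comment> \<open>The exponent is nonpositive, so the lower end of the shell gives the largest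
      value.\<close>
    also have "?b powr (- (2 * (s' - s))) \<le> (4 ^ k) powr (- (2 * (s' - s)))"
      using shell[OF \<xi>] \<open>s \<le> s'\<close> by (intro powr_mono2') auto
    also have "(4 ^ k :: real) = 2 powr (2 * real k)"
      by (simp add: powr_powr[symmetric] powr_realpow flip: powr_powr)
    also have "(2 powr (2 * real k)) powr (- (2 * (s' - s))) = ?q"
      by (simp add: powr_powr algebra_simps)
    finally have "?b powr (2 * s) \<le> ?q * ?b powr (2 * s')" by (simp add: mult_right_mono)
    then have "exp (2 * \<sigma> * norm (freq \<xi>)) * ?b powr (2 * s) * (norm (fourier_coeff ?u \<xi>))\<^sup>2
      \<le> exp (2 * \<sigma> * norm (freq \<xi>)) * (?q * ?b powr (2 * s')) * (norm (fourier_coeff ?u \<xi>))\<^sup>2"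
      by (intro mult_right_mono mult_left_mono) auto
    then show "H_term \<sigma> s ?u \<xi> \<le> ?q * H_term \<sigma> s' ?u \<xi>"
      unfolding H_term_def by (simp only: mult_ac)
  qed
  also have "\<dots> = ?q * sum (H_term \<sigma> s' ?u) F" by (simp add: sum_distrib_left)
  also have "\<dots> \<le> ?q * (exp (4 * \<sigma> * real ?d) * (2 * real ?d * 3 ^ (?d - 1) * (2 ^ k) ^ (?d - 1)) * ?M)"
    by (intro mult_left_mono le) simp
  also have "\<dots> = exp (4 * \<sigma> * real ?d) * (2 * real ?d * 3 ^ (?d - 1)) * (?q * (2 ^ k) ^ (?d - 1)) * ?M"
    by (simp only: mult_ac)
  also have "?q * (2 ^ k) ^ (?d - 1) = (2 powr (real ?d - 1 - 4 * (s' - s))) ^ k"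
  proof -
    have "((2::real) ^ k) ^ (?d - 1) = 2 powr real (k * (?d - 1))"
      by (simp only: powr_realpow power_mult zero_less_numeral)
    also have "real (k * (?d - 1)) = (real ?d - 1) * real k"
      by (simp add: of_nat_diff Suc_leI)
    finally have "((2::real) ^ k) ^ (?d - 1) = 2 powr ((real ?d - 1) * real k)" .
    moreover have "(2 powr (real ?d - 1 - 4 * (s' - s))) ^ k = 2 powr ((real ?d - 1 - 4 * (s' - s)) * real k)"
      by (simp add: powr_powr flip: powr_realpow)
    ultimately show ?thesis by (simp add: algebra_simps flip: powr_add)
  qed
  finally show ?thesis .
qed

lemma ex_H_norm_slice_bound_same_width:
  fixes \<sigma> s s' :: real
  assumes \<sigma>: "0 < \<sigma>" and s': "s + (real CARD('n) - 1) / 4 < s'"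
  shows "\<exists>C>0. \<forall>U :: complex ^ 'n \<Rightarrow> complex.
    holomorphic_in_strip \<sigma> U \<and> slice_sup_finite \<sigma> s' U \<longrightarrow>
      slice U 0 \<in> H_space \<sigma> s \<and> H_norm \<sigma> s (slice U 0) \<le> C * slice_sup \<sigma> s' U"
proof -
  define A where "A = exp (4 * \<sigma> * real CARD('n)) * (2 * real CARD('n) * 3 ^ (CARD('n) - 1))"
  define r where "r = (2::real) powr (real CARD('n) - 1 - 4 * (s' - s))"
  have A: "0 < A" by (simp add: A_def)
  \<comment> \<open>The ratio r of the shell bounds is below 1 exactly when s' - s > (d -
    1)/4.\<close>
  have "real CARD('n) - 1 - 4 * (s' - s) < 0" using s' by (simp add: field_simps)
  then have "r < 2 powr 0" unfolding r_def by (intro powr_less_mono) auto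
  then have r: "0 < r" "r < 1" by (auto simp: r_def)
  have card: "1 \<le> real CARD('n)" using zero_less_card_finite[where 'a = 'n] by linarith
  then have "0 \<le> (real CARD('n) - 1) / 4" by simp
  then have ss: "s \<le> s'" using s' by linarith
  \<comment> \<open>The sum of the geometric series of shell bounds; the norm bound takes its square
    root.\<close>
  define B where "B = A / (1 - r)"
  have B: "0 < B" using A r by (simp add: B_def)
  have "slice U 0 \<in> H_space \<sigma> s \<and> H_norm \<sigma> s (slice U 0) \<le> sqrt B * slice_sup \<sigma> s' U"
    if hol: "holomorphic_in_strip \<sigma> U" and fin: "slice_sup_finite \<sigma> s' U"
    for U :: "complex ^ 'n \<Rightarrow> complex"
  proof -
    let ?h = "H_term \<sigma> s (slice U 0)" and ?M = "(slice_sup \<sigma> s' U)\<^sup>2"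
    have "sum ?h F \<le> (sqrt B * slice_sup \<sigma> s' U)\<^sup>2" if F: "finite F" for F
    proof -
      \<comment> \<open>A finite set of frequencies meets finitely many shells, so it is split along
        a choice of shell index and the full geometric series bounds the result.\<close>
      obtain \<kappa> :: "int ^ 'n \<Rightarrow> nat" where
        \<kappa>: "\<And>\<xi>. 4 ^ \<kappa> \<xi> \<le> japanese_bracket \<xi> \<and> japanese_bracket \<xi> < 4 ^ Suc (\<kappa> \<xi>)"
        using japanese_bracket_shell by metis
      have "sum ?h F = (\<Sum>k\<in>\<kappa> ` F. sum ?h {\<xi> \<in> F. \<kappa> \<xi> = k})"
        using F by (intro sum.group[symmetric]) auto
      also have "\<dots> \<le> (\<Sum>k\<in>\<kappa> ` F. A * r ^ k * ?M)"
        unfolding A_def r_def using F \<kappa>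
        by (intro sum_mono sum_H_term_shell_le[OF hol fin \<sigma> _ ss]) auto
      also have "\<dots> = A * ?M * (\<Sum>k\<in>\<kappa> ` F. r ^ k)"
        unfolding sum_distrib_left by (intro sum.cong) (simp_all add: mult_ac)
      also have "\<dots> \<le> A * ?M * (1 / (1 - r))"
      proof (rule mult_left_mono)
        have "(\<Sum>k\<in>\<kappa> ` F. r ^ k) \<le> (\<Sum>k. r ^ k)"
          using r F by (intro sum_le_suminf summable_geometric) auto
        then show "(\<Sum>k\<in>\<kappa> ` F. r ^ k) \<le> 1 / (1 - r)"
          using r by (simp add: suminf_geometric)
      qed (use A in auto)
      also have "\<dots> = (sqrt B * slice_sup \<sigma> s' U)\<^sup>2"
        using B by (simp add: power_mult_distrib) (simp add: B_def)
      finally show ?thesis .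
    qed
    then show ?thesis
      using H_space_of_sum_bound[OF slice_zero_L2_torus[OF fin \<sigma>], where B = "sqrt B * slice_sup \<sigma> s' U"]
        slice_sup_nonneg[OF fin \<sigma>] B by simp
  qed
  then show ?thesis using B by (intro exI[of _ "sqrt B"]) auto
qed

text \<open>Each C is chosen before \<open>U\<close>, so it depends only on the dimension, the
  widths and the exponents.\<close>

theorem theorem1p1:
  fixes \<sigma> s :: real
  assumes "\<sigma> > 0" and "s \<ge> 0"
  shows
    "(CARD('n::finite) = 1 \<longrightarrow>
        (\<forall>U :: complex ^ 'n \<Rightarrow> complex.
           holomorphic_in_strip \<sigma> U \<and> slice_sup_finite \<sigma> s U \<longrightarrow>
             slice U 0 \<in> H_space \<sigma> s \<and>
             H_norm \<sigma> s (slice U 0) \<le> 2 * slice_sup \<sigma> s U))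
     \<and>
     (CARD('n) \<ge> 2 \<longrightarrow>
        (\<forall>\<delta>. 0 \<le> \<delta> \<and> \<delta> < \<sigma> \<longrightarrow>
          (\<exists>C>0. \<forall>U :: complex ^ 'n \<Rightarrow> complex.
             holomorphic_in_strip \<sigma> U \<and> slice_sup_finite \<sigma> s U \<longrightarrow>
               slice U 0 \<in> H_space \<delta> s \<and>
               H_norm \<delta> s (slice U 0) \<le> C * slice_sup \<sigma> s U)))
     \<and>
     (\<forall>s'. s' > s + (real CARD('n) - 1) / 4 \<longrightarrow>
        (\<exists>C>0. \<forall>U :: complex ^ 'n \<Rightarrow> complex.
           holomorphic_in_strip \<sigma> U \<and> slice_sup_finite \<sigma> s' U \<longrightarrow>
             slice U 0 \<in> H_space \<sigma> s \<and>
             H_norm \<sigma> s (slice U 0) \<le> C * slice_sup \<sigma> s' U))"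
  using H_norm_slice_le_one_dim[OF _ assms(1)] ex_H_norm_slice_bound_smaller_width[OF assms(1)]
    ex_H_norm_slice_bound_same_width[OF assms(1)]
  by blast

end
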